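(* Let $(X,\mu)$ be a weighted graph satisfying $(U)$. Then for any $x\in X$ and any $\epsilon>0$, $$\lim_{n\to\infty}P_x\bigl(R_n\ge n(1-F_1+\epsilon)\bigr)=0 \quad\text{and}\quad \lim_{n\to\infty}P_x\bigl(R_n\le n(1-F_2-\epsilon)\bigr)=0 .$$ For each $\epsilon>0$ both convergences are uniform with respect to $x\in X$. Moreover, the convergence in the first limit is exponentially fast in $n$.
   Context: A weighted graph $(X,\mu)$ is an infinite connected graph $X$ with a symmetric function $\mu:X\times X\to[0,\infty)$, $(x,y)\mapsto\mu_{xy}$, such that $\mu_{xy}>0$ if and only if $x\sim y$ (i.e. $x$ and $y$ are joined by an edge). Standing assumptions: $\sup_{x\in X}\deg(x)<+\infty$ and $0<\inf_{x\sim y}\mu_{xy}\le\sup_{x\sim y}\mu_{xy}<+\infty$. Put $\mu_x=\sum_{y\in X}\mu_{xy}$. $\{S_n\}_{n\ge0}$ is the Markov chain on $X$ with transition probabilities $P(S_{n+1}=y\mid S_n=x)=\mu_{xy}/\mu_x$; $P_x$ is its law when $S_0=x$. The range is $R_n=|\{S_0,\dots,S_{n-1}\}|$. Let $T_x^+=\inf\{n\ge1:S_n=x\}$, $F_1=\inf_{x\in X}P_x(T_x^+<+\infty)$, $F_2=\sup_{x\in X}P_x(T_x^+<+\infty)$. Let $d$ be the graph metric, $B(x,n)=\{y\in X:d(x,y)<n\}$. For $f:X\to\mathbb{R}$ let $\mathcal{E}(f,f)=\frac12\sum_{x,y\in X,\,x\sim y}(f(x)-f(y))^2\mu_{xy}$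 and for disjoint $A,B\subset X$ define the effective resistance by $R_{\mathrm{eff}}(A,B)^{-1}=\inf\{\mathcal{E}(f,f):f|_A=1,\ f|_B=0\}$. Let $\rho(x,n)=R_{\mathrm{eff}}(\{x\},B(x,n)^c)$ and $\rho(x)=\lim_{n\to\infty}\rho(x,n)\in(0,+\infty]$. If the chain is recurrent then $\rho(x)=+\infty$ for all $x$; if it is transient then $\rho(x)<+\infty$ for all $x$. Condition $(U)$: $\rho(x,n)$ converges to $\rho(x)$ as $n\to\infty$ uniformly in $x\in X$ (in the recurrent case this means $\inf_{x\in X}\rho(x,n)\to+\infty$). A nonnegative sequence $a_n$ converges to $0$ exponentially fast if there are constants $C,c>0$ with $a_n\le Ce^{-cn}$ for all $n\ge1$. *)

theory Defs
  imports "HOL-Probability.Probability"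
begin

text \<open>
  The vertex set is the whole type \<open>'a\<close>. Loops are allowed: nothing forces
  \<open>adj x x\<close> to be false. Countability of \<open>'a\<close> follows from connectedness and finite degrees.
\<close>

locale weighted_graph =
  fixes adj :: "'a \<Rightarrow> 'a \<Rightarrow> bool" and \<mu> :: "'a \<Rightarrow> 'a \<Rightarrow> real"
  assumes infinite_vertices: "infinite (UNIV :: 'a set)"
    and connected: "\<And>x y. adj\<^sup>*\<^sup>* x y"
    and weight_nonneg: "\<And>x y. 0 \<le> \<mu> x y"
    and weight_sym: "\<And>x y. \<mu> x y = \<mu> y x"
    and weight_pos_iff: "\<And>x y. 0 < \<mu> x y \<longleftrightarrow> adj x y"
    and finite_degree: "\<And>x. finite {y. adj x y}"
    and bounded_degree: "bdd_above (range (\<lambda>x. card {y. adj x y}))"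
    and weight_inf_pos: "0 < Inf {\<mu> x y | x y. adj x y}"
    and weight_bounded: "bdd_above {\<mu> x y | x y. adj x y}"

definition vertex_weight :: "('a \<Rightarrow> 'a \<Rightarrow> real) \<Rightarrow> 'a \<Rightarrow> real" where
  "vertex_weight \<mu> x = (\<Sum>\<^sub>\<infinity>y. \<mu> x y)"

definition graph_dist :: "('a \<Rightarrow> 'a \<Rightarrow> bool) \<Rightarrow> 'a \<Rightarrow> 'a \<Rightarrow> nat" where
  "graph_dist adj x y = (LEAST n. (adj ^^ n) x y)"

definition graph_ball :: "('a \<Rightarrow> 'a \<Rightarrow> bool) \<Rightarrow> 'a \<Rightarrow> nat \<Rightarrow> 'a set" where
  "graph_ball adj x n = {y. graph_dist adj x y < n}"

text \<open>The quadratic form \<open>\<E>(f,f)\<close>, which may be infinite.\<close>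

definition energy :: "('a \<Rightarrow> 'a \<Rightarrow> bool) \<Rightarrow> ('a \<Rightarrow> 'a \<Rightarrow> real) \<Rightarrow> ('a \<Rightarrow> real) \<Rightarrow> ennreal" where
  "energy adj \<mu> f =
     (\<Sum>\<^sub>\<infinity>(x, y)\<in>{(x, y). adj x y}. ennreal ((f x - f y)\<^sup>2 * \<mu> x y)) / 2"

text \<open>
  In \<^typ>\<open>ennreal\<close>, \<open>inverse 0 = \<infinity>\<close> and \<open>inverse \<infinity> = 0\<close>. If \<open>A\<close> and \<open>B\<close> meet, the infimum is over the
  empty set and the value is \<open>0\<close>; below this happens only for the radius \<open>n = 0\<close>.
\<close>

definition eff_resistance ::
    "('a \<Rightarrow> 'a \<Rightarrow> bool) \<Rightarrow> ('a \<Rightarrow> 'a \<Rightarrow> real) \<Rightarrow> 'a set \<Rightarrow> 'a set \<Rightarrow> ennreal" where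
  "eff_resistance adj \<mu> A B =
     inverse (INF f\<in>{f. (\<forall>a\<in>A. f a = 1) \<and> (\<forall>b\<in>B. f b = 0)}. energy adj \<mu> f)"

definition resistance_ball ::
    "('a \<Rightarrow> 'a \<Rightarrow> bool) \<Rightarrow> ('a \<Rightarrow> 'a \<Rightarrow> real) \<Rightarrow> 'a \<Rightarrow> nat \<Rightarrow> ennreal" where
  "resistance_ball adj \<mu> x n = eff_resistance adj \<mu> {x} (- graph_ball adj x n)"

definition resistance_inf ::
    "('a \<Rightarrow> 'a \<Rightarrow> bool) \<Rightarrow> ('a \<Rightarrow> 'a \<Rightarrow> real) \<Rightarrow> 'a \<Rightarrow> ennreal" where
  "resistance_inf adj \<mu> x = lim (\<lambda>n. resistance_ball adj \<mu> x n)"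

text \<open>
  Uniform convergence of \<open>[0, \<infinity>]\<close>-valued functions. The limit is finite at every vertex in the
  transient case and infinite at every vertex in the recurrent case, so that one of the two
  conjuncts is always void (an infimum over the empty set is \<open>\<infinity>\<close> in \<^typ>\<open>ennreal\<close>) and the
  other one ranges over all vertices.
\<close>

definition condition_U :: "('a \<Rightarrow> 'a \<Rightarrow> bool) \<Rightarrow> ('a \<Rightarrow> 'a \<Rightarrow> real) \<Rightarrow> bool" where
  "condition_U adj \<mu> \<longleftrightarrow>
     uniform_limit {x. resistance_inf adj \<mu> x < \<infinity>}
       (\<lambda>n x. enn2real (resistance_ball adj \<mu> x n))
       (\<lambda>x. enn2real (resistance_inf adj \<mu> x)) sequentially \<and>
     (\<lambda>n. INF x\<in>{x. resistance_inf adj \<mu> x = \<infinity>}. resistance_ball adj \<mu> x n)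
       \<longlonglongrightarrow> \<infinity>"

text \<open>
  \<open>P x\<close> is the law under which the chain \<open>S\<close> starts at \<open>x\<close>, on an arbitrary sample space. The
  Markov property is the elementary one, conditioning on a history of positive probability.
\<close>

locale random_walk = weighted_graph adj \<mu>
  for adj :: "'a \<Rightarrow> 'a \<Rightarrow> bool" and \<mu> :: "'a \<Rightarrow> 'a \<Rightarrow> real" +
  fixes P :: "'a \<Rightarrow> 'w measure" and S :: "nat \<Rightarrow> 'w \<Rightarrow> 'a"
  assumes prob_space_law: "\<And>x. prob_space (P x)"
    and measurable_chain: "\<And>x n. S n \<in> measurable (P x) (count_space UNIV)"
    and start: "\<And>x. AE \<omega> in P x. S 0 \<omega> = x"
    and markov: "\<And>x n s y. 0 < \<P>(\<omega> in P x. \<forall>i\<le>n. S i \<omega> = s i) \<Longrightarrow>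
      \<P>(\<omega> in P x. S (Suc n) \<omega> = y \<bar> \<forall>i\<le>n. S i \<omega> = s i) = \<mu> (s n) y / vertex_weight \<mu> (s n)"

definition range_size :: "(nat \<Rightarrow> 'w \<Rightarrow> 'a) \<Rightarrow> nat \<Rightarrow> 'w \<Rightarrow> nat" where
  "range_size S n \<omega> = card ((\<lambda>i. S i \<omega>) ` {..<n})"

definition return_time :: "(nat \<Rightarrow> 'w \<Rightarrow> 'a) \<Rightarrow> 'a \<Rightarrow> 'w \<Rightarrow> enat" where
  "return_time S x \<omega> = (INF n\<in>{n. 1 \<le> n \<and> S n \<omega> = x}. enat n)"

definition return_prob :: "('a \<Rightarrow> 'w measure) \<Rightarrow> (nat \<Rightarrow> 'w \<Rightarrow> 'a) \<Rightarrow> 'a \<Rightarrow> real" where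
  "return_prob P S x = \<P>(\<omega> in P x. return_time S x \<omega> < \<infinity>)"

definition F1 :: "('a \<Rightarrow> 'w measure) \<Rightarrow> (nat \<Rightarrow> 'w \<Rightarrow> 'a) \<Rightarrow> real" where
  "F1 P S = (INF x. return_prob P S x)"

definition F2 :: "('a \<Rightarrow> 'w measure) \<Rightarrow> (nat \<Rightarrow> 'w \<Rightarrow> 'a) \<Rightarrow> real" where
  "F2 P S = (SUP x. return_prob P S x)"

definition exponentially_fast :: "(nat \<Rightarrow> real) \<Rightarrow> bool" where
  "exponentially_fast a \<longleftrightarrow>
     (\<exists>C>0. \<exists>c>0. \<forall>n\<ge>1. a n \<le> C * exp (- c * real n))"

end

theory Submission
  imports Defs "HOL-Real_Asymp.Real_Asymp"
begin

text \<open>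
  The number of visited points is subadditive under concatenation of trajectories, so the exponential
  moments of \<open>R\<^sub>n\<close> are submultiplicative uniformly in the starting point, and an exponential tail
  bound follows from a bound \<open>E\<^sub>x R\<^sub>L \<le> q L + O(1)\<close> for one large \<open>L\<close>. Counting each point at its last
  visit bounds \<open>E\<^sub>x R\<^sub>L\<close> by the probabilities of not returning within a fixed time \<open>m\<close>. For the lower tail,
  \<open>n - R\<^sub>n\<close> is split into the number of returns within time \<open>m\<close>, to which the same exponential
  estimate applies, and the number of later returns, whose mean is at most \<open>\<delta> n\<close>.

  Both parts need the return probability to be approximated uniformly in \<open>x\<close> by the probability of a
  return within time \<open>m\<close>. By Dirichlet's principle \<open>1 / \<rho>(x,n)\<close> is \<open>\<mu>\<^sub>x\<close> times the probability of leaving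
  \<open>B(x,n)\<close> before returning to \<open>x\<close>, so \<open>(U)\<close> makes these escape probabilities converge uniformly; and
  the walk spends only a uniformly short time in \<open>B(x,n)\<close> before leaving it or hitting \<open>x\<close>.
\<close>

section \<open>Counting functionals of finite lists\<close>

text \<open>The range, the quick returns and the late returns are all counts of this form, so that
  the single estimate \<open>E_tail_count_le\<close> bounds all their means.\<close>

fun tail_count :: "('a \<Rightarrow> 'a list \<Rightarrow> bool) \<Rightarrow> 'a list \<Rightarrow> nat" where
  "tail_count Q [] = 0"
| "tail_count Q (x # xs) = of_bool (Q x xs) + tail_count Q xs"

lemma tail_count_le_length: "tail_count Q xs \<le> length xs"
  by (induction xs) auto

text \<open>Every visited point has exactly one last visit.\<close>

lemma card_set_eq_tail_count: "card (set xs) = tail_count (\<lambda>x xs. x \<notin> set xs) xs"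
  by (induction xs) (auto simp: card_insert_if)

text \<open>Each position is a last visit, or its point recurs within \<open>m\<close> steps, or it
  recurs only later.\<close>

lemma length_le_card_set_plus:
  "length xs \<le> card (set xs) + tail_count (\<lambda>x xs. x \<in> set (take m xs)) xs
     + tail_count (\<lambda>x xs. x \<in> set xs \<and> x \<notin> set (take m xs)) xs"
  by (induction xs) (auto simp: card_insert_if)

text \<open>Only the last \<open>m\<close> positions of \<open>xs\<close> look into
  \<open>ys\<close>.\<close>

lemma tail_count_take_append:
  "tail_count (\<lambda>x xs. x \<in> set (take m xs)) (xs @ ys)
     \<le> tail_count (\<lambda>x xs. x \<in> set (take m xs)) xs + m
        + tail_count (\<lambda>x xs. x \<in> set (take m xs)) ys"
proof -
  \<comment> \<open>The induction needs the sharper error \<open>min m (length xs)\<close>: in a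
    list shorter than \<open>m\<close> every new entry may add one.\<close>
  have "tail_count (\<lambda>x xs. x \<in> set (take m xs)) (xs @ ys)
     \<le> tail_count (\<lambda>x xs. x \<in> set (take m xs)) xs + min m (length xs)
        + tail_count (\<lambda>x xs. x \<in> set (take m xs)) ys"
  proof (induction xs)
    case (Cons x xs)
    show ?case
    proof (cases "m \<le> length xs")
      case False
      then have "min m (length (x # xs)) = Suc (min m (length xs))" by simp
      moreover have "of_bool (x \<in> set (take m (xs @ ys))) \<le> (1 :: nat)" by simp
      ultimately show ?thesis using Cons unfolding append_Cons tail_count.simps by linarith
    qed (use Cons in simp)
  qed simp
  then show ?thesis by linarith
qed

section \<open>Uniform bounds on weights and transition probabilities\<close>

context weighted_graph
begin

lemma weight_eq_0: "\<not> adj x y \<Longrightarrow> \<mu> x y = 0"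
  using weight_nonneg[of x y] weight_pos_iff[of x y] by linarith

lemma adj_sym: "adj x y \<Longrightarrow> adj y x"
  by (metis weight_pos_iff weight_sym)

lemma vertex_weight_eq_sum: "vertex_weight \<mu> x = (\<Sum>y | adj x y. \<mu> x y)"
proof -
  have "vertex_weight \<mu> x = (\<Sum>\<^sub>\<infinity>y\<in>{y. adj x y}. \<mu> x y)"
    unfolding vertex_weight_def by (rule infsum_cong_neutral) (auto simp: weight_eq_0)
  then show ?thesis using finite_degree by simp
qed

lemma ex_neighbour: "\<exists>y. adj x y"
proof -
  obtain z where "z \<noteq> x" using infinite_vertices
    by (metis (full_types) finite.emptyI finite.insertI finite_subset insertCI subsetI)
  then show ?thesis using connected[of x z] by (metis converse_rtranclpE)
qed

lemma vertex_weight_pos: "vertex_weight \<mu> x > 0"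
  unfolding vertex_weight_eq_sum
  using finite_degree[of x] ex_neighbour[of x] by (intro sum_pos) (auto simp: weight_pos_iff)

lemma vertex_weight_bounded:
  obtains W where "W > 0" "\<And>x. vertex_weight \<mu> x \<le> W"
proof -
  obtain D where D: "\<And>x. card {y. adj x y} \<le> D"
    using bounded_degree by (auto simp: bdd_above_def)
  obtain w where w: "\<And>x y. adj x y \<Longrightarrow> \<mu> x y \<le> w"
    using weight_bounded by (auto simp: bdd_above_def)
  have w0: "w > 0" using w ex_neighbour weight_pos_iff by (metis less_le_trans)
  have *: "vertex_weight \<mu> x \<le> real D * w" for x
  proof -
    have "vertex_weight \<mu> x \<le> real (card {y. adj x y}) * w"
      unfolding vertex_weight_eq_sum by (rule sum_bounded_above) (simp add: w)
    also have "\<dots> \<le> real D * w"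
      using D w0 by (intro mult_right_mono) auto
    finally show ?thesis .
  qed
  with vertex_weight_pos[of undefined] have "real D * w > 0" by (meson less_le_trans)
  with * show ?thesis by (rule that[rotated])
qed

lemma weight_bounded_below:
  obtains w where "w > 0" "\<And>x y. adj x y \<Longrightarrow> w \<le> \<mu> x y"
proof -
  have "Inf {\<mu> x y | x y. adj x y} \<le> \<mu> x y" if "adj x y" for x y
    using that weight_nonneg by (intro cInf_lower bdd_belowI[of _ 0]) auto
  with weight_inf_pos show ?thesis by (rule that)
qed

lemma weight_le_vertex_weight: "adj x y \<Longrightarrow> \<mu> x y \<le> vertex_weight \<mu> x"
  unfolding vertex_weight_eq_sum
  using weight_nonneg finite_degree by (intro member_le_sum) auto

lemma vertex_weight_bounded_below:
  obtains w where "w > 0" "\<And>x. w \<le> vertex_weight \<mu> x"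
proof -
  obtain w where w: "w > 0" "\<And>x y. adj x y \<Longrightarrow> w \<le> \<mu> x y"
    by (rule weight_bounded_below) blast
  have "w \<le> vertex_weight \<mu> x" for x
    using ex_neighbour[of x] w(2) weight_le_vertex_weight by (meson order_trans)
  with w(1) show ?thesis by (rule that)
qed

text \<open>The ratio of the lower bound on edge weights to the upper bound on vertex weights serves
  as \<open>p\<close>; any single edge shows that it is at most 1.\<close>

lemma transition_bounded_below:
  obtains p where "0 < p" "p \<le> 1" "\<And>x y. adj x y \<Longrightarrow> p \<le> \<mu> x y / vertex_weight \<mu> x"
proof -
  obtain W where W: "W > 0" "\<And>x. vertex_weight \<mu> x \<le> W" by (rule vertex_weight_bounded) blast
  obtain m where m0: "m > 0" and m: "\<And>x y. adj x y \<Longrightarrow> m \<le> \<mu> x y"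
    by (rule weight_bounded_below) blast
  have le: "m / W \<le> \<mu> x y / vertex_weight \<mu> x" if "adj x y" for x y
    using m[OF that] W(2)[of x] vertex_weight_pos[of x] weight_nonneg
    by (intro frac_le) auto
  obtain a b where ab: "adj a b" using ex_neighbour by blast
  have "\<mu> a b \<le> vertex_weight \<mu> a" using ab by (rule weight_le_vertex_weight)
  then have "\<mu> a b / vertex_weight \<mu> a \<le> 1" using vertex_weight_pos[of a] by simp
  with le[OF ab] have "m / W \<le> 1" by linarith
  moreover have "m / W > 0" using m0 W by simp
  ultimately show ?thesis using le that by blast
qed

section \<open>The transition operator\<close>

definition avg :: "('a \<Rightarrow> real) \<Rightarrow> 'a \<Rightarrow> real" where
  "avg f x = (\<Sum>y | adj x y. \<mu> x y / vertex_weight \<mu> x * f y)"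

lemma avg_mono: "(\<And>y. adj x y \<Longrightarrow> f y \<le> g y) \<Longrightarrow> avg f x \<le> avg g x"
  unfolding avg_def using weight_nonneg vertex_weight_pos[of x]
  by (intro sum_mono mult_left_mono) auto

lemma avg_const: "avg (\<lambda>_. c) x = c"
proof -
  have "avg (\<lambda>_. c) x = (\<Sum>y | adj x y. \<mu> x y) / vertex_weight \<mu> x * c"
    by (simp add: avg_def sum_distrib_right sum_divide_distrib)
  then show ?thesis using vertex_weight_pos[of x] by (simp flip: vertex_weight_eq_sum)
qed

lemma avg_diff: "avg (\<lambda>y. f y - g y) x = avg f x - avg g x"
  by (simp add: avg_def sum_subtractf right_diff_distrib)

lemma avg_cmult: "avg (\<lambda>y. c * f y) x = c * avg f x"
  by (simp add: avg_def sum_distrib_left mult_ac)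

lemma avg_nonneg: "(\<And>y. 0 \<le> f y) \<Longrightarrow> 0 \<le> avg f x"
  using avg_mono[of x "\<lambda>_. 0" f] by (simp add: avg_const)

lemma avg_le: "(\<And>y. adj x y \<Longrightarrow> f y \<le> c) \<Longrightarrow> avg f x \<le> c"
  using avg_mono[of x f "\<lambda>_. c"] by (simp add: avg_const)

text \<open>The favoured neighbour \<open>y\<close> carries mass at least \<open>p\<close>; since
  \<open>a \<le> b\<close>, lowering its mass to \<open>p\<close> can only raise the bound. This
  gives the drift in \<open>hitting_diff_le\<close>.\<close>

lemma avg_le_single:
  assumes "adj x y" and "\<And>z. adj x z \<Longrightarrow> f z \<le> b" and "f y \<le> a" and "a \<le> b"
    and "p \<le> \<mu> x y / vertex_weight \<mu> x"
  shows "avg f x \<le> p * a + (1 - p) * b"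
proof -
  let ?q = "\<mu> x y / vertex_weight \<mu> x"
  have "avg f x \<le> avg (\<lambda>z. if z = y then a else b) x"
    using assms by (intro avg_mono) auto
  also have "\<dots> = avg (\<lambda>z. b - (if z = y then b - a else 0)) x"
    by (intro arg_cong2[where f = avg] ext) auto
  also have "\<dots> = b - ?q * (b - a)"
    unfolding avg_diff avg_const using assms(1) finite_degree[of x]
    by (simp add: avg_def if_distrib[of "\<lambda>t. _ * t"] cong: if_cong)
  also have "\<dots> \<le> b - p * (b - a)"
    using assms by (intro diff_left_mono mult_right_mono) auto
  finally show ?thesis by (simp add: algebra_simps)
qed

lemma tendsto_avg:
  "(\<And>y. (\<lambda>n. f n y) \<longlonglongrightarrow> g y) \<Longrightarrow> (\<lambda>n. avg (f n) x) \<longlonglongrightarrow> avg g x"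
  unfolding avg_def by (intro tendsto_intros) auto

section \<open>Graph distance and balls\<close>

abbreviation dst :: "'a \<Rightarrow> 'a \<Rightarrow> nat" where "dst \<equiv> graph_dist adj"
abbreviation gball :: "'a \<Rightarrow> nat \<Rightarrow> 'a set" where "gball \<equiv> graph_ball adj"

lemma relpowp_dst: "(adj ^^ dst x y) x y"
  unfolding graph_dist_def using connected[of x y] by (metis LeastI rtranclp_imp_relpowp)

lemma dst_le: "(adj ^^ n) x y \<Longrightarrow> dst x y \<le> n"
  unfolding graph_dist_def by (rule Least_le)

lemma dst_self [simp]: "dst x x = 0"
  using dst_le[of 0 x x] by simp

lemma dst_eq_0_iff [simp]: "dst x y = 0 \<longleftrightarrow> x = y"
  using relpowp_dst[of x y] by auto

lemma dst_adj: "adj y z \<Longrightarrow> dst x z \<le> Suc (dst x y)"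
  using relpowp_dst[of x y] by (intro dst_le) auto

text \<open>Take the last vertex before \<open>y\<close> on a shortest path from
  \<open>x\<close>.\<close>

lemma dst_descend:
  assumes "x \<noteq> y" obtains z where "adj y z" "dst x y = Suc (dst x z)"
proof -
  obtain n where n: "dst x y = Suc n" using assms by (metis dst_eq_0_iff not0_implies_Suc)
  then obtain z where z: "(adj ^^ n) x z" "adj z y" using relpowp_dst[of x y] by auto
  with n dst_le[OF z(1)] dst_adj[OF z(2), of x] have "dst x y = Suc (dst x z)" by linarith
  with z show ?thesis using that adj_sym by blast
qed

lemma finite_relpowp: "finite {y. (adj ^^ n) x y}"
proof (induction n)
  case (Suc n)
  have "{y. (adj ^^ Suc n) x y} = (\<Union>z\<in>{z. (adj ^^ n) x z}. {y. adj z y})" by auto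
  then show ?case using Suc finite_degree by simp
qed simp

lemma finite_ball: "finite (gball x n)"
proof (rule finite_subset)
  show "gball x n \<subseteq> (\<Union>k<n. {y. (adj ^^ k) x y})"
    unfolding graph_ball_def using relpowp_dst by blast
qed (simp add: finite_relpowp)

text \<open>Used for the measurability of trajectories and to recover their law from point
  masses.\<close>

lemma countable_vertices: "countable (UNIV :: 'a set)"
proof -
  have "UNIV = (\<Union>k. {y. (adj ^^ k) undefined y})" using relpowp_dst by blast
  also have "countable \<dots>" by (simp add: finite_relpowp countable_finite)
  finally show ?thesis .
qed

subsection \<open>Hitting, escape and return probabilities\<close>

text \<open>
  The probability that the walk from \<open>y\<close> is at \<open>x\<close> at one of the times \<open>0, \<dots>, n - 1\<close>, before it is
  killed on leaving \<open>B\<close>.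
\<close>

primrec hit :: "'a set \<Rightarrow> 'a \<Rightarrow> nat \<Rightarrow> 'a \<Rightarrow> real" where
  "hit B x 0 y = 0"
| "hit B x (Suc n) y = (if y = x then 1 else if y \<in> B then avg (hit B x n) y else 0)"

lemma hit_nonneg: "0 \<le> hit B x n y"
  by (induction n arbitrary: y) (auto intro: avg_nonneg)

lemma hit_le_1: "hit B x n y \<le> 1"
  by (induction n arbitrary: y) (auto intro: avg_le)

lemma hit_Suc_mono: "hit B x n y \<le> hit B x (Suc n) y"
  by (induction n arbitrary: y) (auto intro: avg_mono avg_nonneg)

lemma hit_mono: "m \<le> n \<Longrightarrow> hit B x m y \<le> hit B x n y"
  by (rule lift_Suc_mono_le[of "\<lambda>n. hit B x n y"]) (rule hit_Suc_mono)

lemma hit_mono_set: "A \<subseteq> B \<Longrightarrow> hit A x n y \<le> hit B x n y"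
  by (induction n arbitrary: y) (auto intro!: avg_mono avg_nonneg hit_nonneg)

text \<open>Up to time \<open>n - 1\<close> the walk crosses at most \<open>n - 1\<close>
  edges.\<close>

lemma hit_far: "n \<le> dst x y \<Longrightarrow> hit B x n y = 0"
proof (induction n arbitrary: y)
  case (Suc n)
  then have "x \<noteq> y" by auto
  moreover have "avg (hit B x n) y = avg (\<lambda>_. 0) y"
    unfolding avg_def
  proof (intro sum.cong refl)
    fix z assume "z \<in> {z. adj y z}"
    then have "dst x y \<le> Suc (dst x z)" using dst_adj[of z y x] adj_sym by auto
    then show "\<mu> y z / vertex_weight \<mu> y * hit B x n z = \<mu> y z / vertex_weight \<mu> y * 0"
      using Suc by simp
  qed
  ultimately show ?case by (simp add: avg_const)
qed simp

text \<open>A walk that reaches \<open>x\<close> by time \<open>n - 1\<close> stays at distance less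
  than \<open>n\<close> from \<open>x\<close> until then, so killing it outside the ball changes
  nothing.\<close>

lemma hit_UNIV_eq_ball: "n \<le> m \<Longrightarrow> hit UNIV x n y = hit (gball x m) x n y"
proof (induction n arbitrary: y)
  case (Suc n)
  show ?case
  proof (cases "y \<in> gball x m")
    case True
    have "hit UNIV x n = hit (gball x m) x n" using Suc by auto
    then show ?thesis using True by simp
  next
    case False
    then have "Suc n \<le> dst x y" using Suc.prems unfolding graph_ball_def by simp
    then show ?thesis by (simp only: hit_far)
  qed
qed simp

text \<open>Defined as a limit of finite-time probabilities, so that it depends on the weights alone
  and not on a sample space.\<close>

definition hitting :: "'a set \<Rightarrow> 'a \<Rightarrow> 'a \<Rightarrow> real" where
  "hitting B x y = (SUP n. hit B x n y)"

lemma bdd_hit: "bdd_above (range (\<lambda>n. hit B x n y))"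
  using hit_le_1 by (intro bdd_aboveI[of _ 1]) auto

lemma tendsto_hitting: "(\<lambda>n. hit B x n y) \<longlonglongrightarrow> hitting B x y"
  unfolding hitting_def
  by (intro LIMSEQ_incseq_SUP bdd_hit) (auto simp: incseq_def hit_mono)

lemma hit_le_hitting: "hit B x n y \<le> hitting B x y"
  unfolding hitting_def by (intro cSUP_upper bdd_hit) auto

lemma hitting_le_1: "hitting B x y \<le> 1"
  unfolding hitting_def by (intro cSUP_least hit_le_1) auto

lemma hitting_mono: "A \<subseteq> B \<Longrightarrow> hitting A x y \<le> hitting B x y"
  unfolding hitting_def by (intro cSUP_mono bdd_hit) (auto intro: hit_mono_set)

text \<open>The first-step recursion survives the limit. It says that \<open>hitting B x\<close> is
  harmonic on \<open>B\<close> away from \<open>x\<close>, the property behind Dirichlet's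
  principle.\<close>

lemma hitting_eq:
  "hitting B x y = (if y = x then 1 else if y \<in> B then avg (hitting B x) y else 0)"
proof (rule LIMSEQ_unique)
  show "(\<lambda>n. hit B x (Suc n) y) \<longlonglongrightarrow> hitting B x y"
    by (intro LIMSEQ_Suc tendsto_hitting)
  show "(\<lambda>n. hit B x (Suc n) y) \<longlonglongrightarrow>
      (if y = x then 1 else if y \<in> B then avg (hitting B x) y else 0)"
    by (auto intro: tendsto_avg tendsto_hitting)
qed

text \<open>
  With \<open>s = p / 2\<close>, the function \<open>y \<mapsto> 1 - s ^ dst x y\<close> is a strict supersolution for the walk killed
  at \<open>x\<close>: a step towards \<open>x\<close> has probability at least \<open>p\<close>, and \<open>p / s = 2\<close> outweighs all other steps.
\<close>

lemma hitting_diff_le: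
  assumes p: "0 < p" "p \<le> 1" "\<And>x y. adj x y \<Longrightarrow> p \<le> \<mu> x y / vertex_weight \<mu> x"
  shows "hitting (gball x m) x y - hit (gball x m) x (Suc n) y
    \<le> 2 * (1 - (p/2)^m) ^ n * (1 - (p/2) ^ dst x y)"
proof (induction n arbitrary: y)
  case 0
  show ?case
  proof (cases "y = x")
    case False
    then have "1 \<le> dst x y" by (cases "dst x y") auto
    \<comment> \<open>Away from \<open>x\<close> the last factor is at least 1/2, so the leading
      factor 2 lifts the right-hand side to at least 1.\<close>
    then have "(p/2) ^ dst x y \<le> (p/2) ^ 1"
      using p by (intro power_decreasing) auto
    then have "(p/2) ^ dst x y \<le> 1/2" using p by simp
    then show ?thesis
      using hitting_le_1[of "gball x m" x y] hit_nonneg[of "gball x m" x "Suc 0" y]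
      by simp
  qed (simp add: hitting_eq)
next
  case (Suc n)
  define s where "s = p / 2"
  have s: "0 < s" "s \<le> 1/2" using p by (auto simp: s_def)
  have s1: "s ^ k \<le> 1" for k using s by (intro power_le_one) auto
  have rhs: "0 \<le> 2 * (1 - s^m) ^ k * (1 - s ^ dst x y)" for k
    using s1 by simp
  show ?case
  proof (cases "y \<noteq> x \<and> y \<in> gball x m")
    case True
    define d where "d = dst x y"
    obtain z where z: "adj y z" "d = Suc (dst x z)"
      using True dst_descend[of x y] unfolding d_def by metis
    have dm: "d < m" using True unfolding d_def graph_ball_def by simp
    have "avg (\<lambda>z. 1 - s ^ dst x z) y \<le> p * (1 - s ^ (d - 1)) + (1 - p) * (1 - s ^ Suc d)"
    proof (rule avg_le_single[OF z(1)])
      fix w assume "adj y w"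
      then have "dst x w \<le> Suc d" unfolding d_def by (rule dst_adj)
      then show "1 - s ^ dst x w \<le> 1 - s ^ Suc d"
        using s by (intro diff_left_mono power_decreasing) auto
    next
      show "1 - s ^ (d - 1) \<le> 1 - s ^ Suc d"
        using s by (intro diff_left_mono power_decreasing) auto
    qed (use z p in auto)
    also have "\<dots> = 1 - 2 * s ^ d - (1 - p) * s ^ Suc d"
      using z(2) by (simp add: s_def algebra_simps)
    also have "\<dots> \<le> 1 - 2 * s ^ d" using s p by simp
    \<comment> \<open>Inside the ball \<open>d < m\<close>, so one of the two copies of
      \<open>s ^ d\<close> dominates \<open>s ^ m\<close>; this yields a contraction factor
      independent of \<open>d\<close>.\<close>
    also have "\<dots> \<le> 1 - s ^ d - s ^ m"
      using s dm by (simp add: power_decreasing)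
    also have "\<dots> \<le> (1 - s ^ m) * (1 - s ^ d)"
      using s by (simp add: algebra_simps)
    finally have drift: "avg (\<lambda>z. 1 - s ^ dst x z) y \<le> (1 - s ^ m) * (1 - s ^ d)" .
    have "hitting (gball x m) x y - hit (gball x m) x (Suc (Suc n)) y
      = avg (\<lambda>z. hitting (gball x m) x z - hit (gball x m) x (Suc n) z) y"
      unfolding avg_diff using True by (subst hitting_eq) simp
    also have "\<dots> \<le> avg (\<lambda>z. 2 * (1 - s^m) ^ n * (1 - s ^ dst x z)) y"
      using Suc unfolding s_def by (intro avg_mono)
    also have "\<dots> = 2 * (1 - s^m) ^ n * avg (\<lambda>z. 1 - s ^ dst x z) y"
      by (rule avg_cmult)
    also have "\<dots> \<le> 2 * (1 - s^m) ^ n * ((1 - s ^ m) * (1 - s ^ d))"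
      using drift s1 by (intro mult_left_mono) auto
    finally show ?thesis by (simp add: s_def d_def mult_ac)
  next
    case False
    then show ?thesis using rhs[of "Suc n"] unfolding s_def
      by (subst hitting_eq) auto
  qed
qed

text \<open>The first step is taken separately because \<open>hitting\<close> already counts a visit
  at time 0.\<close>

definition escape :: "'a \<Rightarrow> nat \<Rightarrow> real" where
  "escape x m = 1 - avg (hitting (gball x m) x) x"

lemma hitting_nonneg: "0 \<le> hitting B x y"
  using hit_le_hitting[of B x 0 y] by simp

lemma escape_nonneg: "0 \<le> escape x m"
  unfolding escape_def using avg_le[of x _ 1] hitting_le_1 by simp

lemma escape_le_1: "escape x m \<le> 1"
  unfolding escape_def using avg_nonneg hitting_nonneg by simp

lemma escape_antimono: "m \<le> n \<Longrightarrow> escape x n \<le> escape x m"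
  unfolding escape_def
  by (intro diff_left_mono avg_mono hitting_mono) (auto simp: graph_ball_def)

text \<open>The probability of returning to \<open>x\<close> at one of the times \<open>1, \<dots>, n\<close>.\<close>

definition ret :: "nat \<Rightarrow> 'a \<Rightarrow> real" where
  "ret n x = avg (hit UNIV x n) x"

text \<open>A return within \<open>n\<close> steps takes place before the ball of radius
  \<open>n\<close> is left.\<close>

lemma ret_le_escape: "ret n x \<le> 1 - escape x n"
  unfolding ret_def escape_def using hit_UNIV_eq_ball[of n n x] hit_le_hitting
  by (auto intro!: avg_mono)

lemma ret_mono: "m \<le> n \<Longrightarrow> ret m x \<le> ret n x"
  unfolding ret_def by (intro avg_mono hit_mono)

lemma ret_nonneg: "0 \<le> ret n x"
  unfolding ret_def by (intro avg_nonneg hit_nonneg)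

text \<open>The excess is the chance that the walk is still in the ball, undecided between return
  and escape. It decays geometrically at a rate depending only on \<open>p\<close> and
  \<open>m\<close>, so \<open>n\<close> does not depend on \<open>x\<close>.\<close>

lemma no_return_le_escape:
  assumes "\<delta> > 0"
  obtains n where "\<And>x. 1 - ret n x \<le> escape x m + \<delta>"
proof -
  obtain p where p: "0 < p" "p \<le> 1" "\<And>x y. adj x y \<Longrightarrow> p \<le> \<mu> x y / vertex_weight \<mu> x"
    by (rule transition_bounded_below) blast
  define c where "c = 1 - (p/2)^m"
  have "(p/2)^m \<le> 1" using p by (intro power_le_one) auto
  moreover have "0 < (p/2)^m" using p by simp
  ultimately have c: "0 \<le> c" "c < 1" by (auto simp: c_def)
  obtain n where n: "c ^ n < \<delta> / 2"
    using real_arch_pow_inv[of "\<delta>/2" c] assms c by auto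
  have "1 - ret (Suc n) x \<le> escape x m + \<delta>" for x
  proof -
    have "hitting (gball x m) x y - hit UNIV x (Suc n) y \<le> \<delta>" for y
    proof -
      have "hitting (gball x m) x y - hit UNIV x (Suc n) y
          \<le> hitting (gball x m) x y - hit (gball x m) x (Suc n) y"
        by (intro diff_left_mono hit_mono_set) simp
      also have "\<dots> \<le> 2 * c ^ n * (1 - (p/2) ^ dst x y)"
        unfolding c_def by (rule hitting_diff_le) (use p in auto)
      also have "\<dots> \<le> 2 * c ^ n * 1" using c p by (intro mult_left_mono) auto
      finally show ?thesis using n by simp
    qed
    then have "avg (\<lambda>y. hitting (gball x m) x y - hit UNIV x (Suc n) y) x \<le> \<delta>"
      by (intro avg_le)
    then show ?thesis by (simp add: avg_diff ret_def escape_def del: hit.simps)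
  qed
  then show ?thesis by (rule that)
qed

subsection \<open>Effective resistance and escape\<close>

text \<open>Edges not contained in \<open>T\<close> contribute zero, and pairs in \<open>T\<close>
  that are not edges have weight zero.\<close>

lemma energy_eq_finite_sum:
  assumes "finite T" and "\<And>x y. adj x y \<Longrightarrow> x \<notin> T \<or> y \<notin> T \<Longrightarrow> f x = f y"
  shows "energy adj \<mu> f = ennreal ((\<Sum>x\<in>T. \<Sum>y\<in>T. (f x - f y)\<^sup>2 * \<mu> x y) / 2)"
proof -
  have "(\<Sum>\<^sub>\<infinity>(x, y)\<in>{(x, y). adj x y}. ennreal ((f x - f y)\<^sup>2 * \<mu> x y))
      = (\<Sum>\<^sub>\<infinity>(x, y)\<in>T \<times> T. ennreal ((f x - f y)\<^sup>2 * \<mu> x y))"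
  proof (rule infsum_cong_neutral)
    fix e assume "e \<in> {(x, y). adj x y} - T \<times> T"
    then have "f (fst e) = f (snd e)" by (intro assms(2)) auto
    then show "(case e of (x, y) \<Rightarrow> ennreal ((f x - f y)\<^sup>2 * \<mu> x y)) = 0"
      by (simp add: case_prod_unfold)
  qed (auto simp: weight_eq_0)
  also have "\<dots> = (\<Sum>(x, y)\<in>T \<times> T. ennreal ((f x - f y)\<^sup>2 * \<mu> x y))"
    using assms(1) by simp
  also have "\<dots> = ennreal (\<Sum>(x, y)\<in>T \<times> T. (f x - f y)\<^sup>2 * \<mu> x y)"
    by (simp add: case_prod_unfold weight_nonneg)
  also have "(\<Sum>(x, y)\<in>T \<times> T. (f x - f y)\<^sup>2 * \<mu> x y) = (\<Sum>x\<in>T. \<Sum>y\<in>T. (f x - f y)\<^sup>2 * \<mu> x y)"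
    by (simp add: sum.cartesian_product)
  finally show ?thesis
    unfolding energy_def
    by (simp add: ennreal_divide_numeral sum_nonneg weight_nonneg)
qed

lemma weighted_laplacian:
  "(\<Sum>z | adj y z. (h y - h z) * \<mu> y z) = vertex_weight \<mu> y * (h y - avg h y)"
proof -
  have "vertex_weight \<mu> y * avg h y = (\<Sum>z | adj y z. \<mu> y z * h z)"
    unfolding avg_def sum_distrib_left using vertex_weight_pos[of y] by simp
  moreover have "vertex_weight \<mu> y * h y = (\<Sum>z | adj y z. \<mu> y z * h y)"
    by (simp add: vertex_weight_eq_sum sum_distrib_right)
  ultimately show ?thesis
    by (simp add: sum_subtractf algebra_simps)
qed

text \<open>Discrete Green formula. Splitting \<open>g y - g z\<close> gives two sums that agree by
  symmetry of \<open>\<mu>\<close>; \<open>T\<close> contains all neighbours of \<open>B\<close>, so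
  the inner sum is a full Laplacian.\<close>

lemma summation_by_parts:
  assumes "finite T" "B \<subseteq> T" and nb: "\<And>y z. y \<in> B \<Longrightarrow> adj y z \<Longrightarrow> z \<in> T"
    and g: "\<And>y. y \<notin> B \<Longrightarrow> g y = 0"
  shows "(\<Sum>y\<in>T. \<Sum>z\<in>T. (h y - h z) * (g y - g z) * \<mu> y z)
    = 2 * (\<Sum>y\<in>B. g y * (vertex_weight \<mu> y * (h y - avg h y)))"
proof -
  let ?I = "\<Sum>y\<in>T. \<Sum>z\<in>T. g y * ((h y - h z) * \<mu> y z)"
  have "(\<Sum>y\<in>T. \<Sum>z\<in>T. (h y - h z) * (g y - g z) * \<mu> y z)
      = ?I + (\<Sum>y\<in>T. \<Sum>z\<in>T. g z * ((h z - h y) * \<mu> y z))"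
    unfolding sum.distrib[symmetric] by (intro sum.cong refl) (simp add: algebra_simps)
  also have "(\<Sum>y\<in>T. \<Sum>z\<in>T. g z * ((h z - h y) * \<mu> y z)) = ?I"
    by (subst sum.swap) (simp add: weight_sym)
  also have "?I = (\<Sum>y\<in>B. \<Sum>z\<in>T. g y * ((h y - h z) * \<mu> y z))"
    using assms by (intro sum.mono_neutral_right) auto
  also have "\<dots> = (\<Sum>y\<in>B. g y * (\<Sum>z | adj y z. (h y - h z) * \<mu> y z))"
    unfolding sum_distrib_left using assms
    by (intro sum.cong refl sum.mono_neutral_right) (auto simp: weight_eq_0)
  finally show ?thesis by (simp add: weighted_laplacian)
qed

text \<open>Dirichlet's principle with minimiser \<open>h = hitting B x\<close>: as \<open>h\<close>
  is harmonic off \<open>x\<close>, its energy pairing with any admissible function sees only the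
  value at \<open>x\<close>. Positive radius puts \<open>x\<close> into its ball.\<close>

lemma resistance_ball_eq:
  assumes "0 < m"
  shows "resistance_ball adj \<mu> x m = inverse (ennreal (vertex_weight \<mu> x * escape x m))"
proof -
  define B where "B = gball x m"
  \<comment> \<open>\<open>T\<close> contains both ends of every edge along which an admissible
    function can vary.\<close>
  define T where "T = B \<union> (\<Union>y\<in>B. {z. adj y z})"
  define h where "h = hitting B x"
  define c where "c = vertex_weight \<mu> x * escape x m"
  let ?F = "{f. (\<forall>a\<in>{x}. f a = (1::real)) \<and> (\<forall>b\<in>- B. f b = 0)}"
  have fT: "finite T" using finite_ball finite_degree unfolding T_def B_def by auto
  have xB: "x \<in> B" using assms by (simp add: B_def graph_ball_def)
  have en: "energy adj \<mu> f = ennreal ((\<Sum>y\<in>T. \<Sum>z\<in>T. (f y - f z)\<^sup>2 * \<mu> y z) / 2)"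
    if "f \<in> ?F" for f
  proof (rule energy_eq_finite_sum[OF fT])
    fix y z assume "adj y z" "y \<notin> T \<or> z \<notin> T"
    then have "y \<notin> B" "z \<notin> B" unfolding T_def using adj_sym by auto
    then show "f y = f z" using that by auto
  qed
  have form: "(\<Sum>y\<in>T. \<Sum>z\<in>T. (h y - h z) * (f y - f z) * \<mu> y z) = 2 * c" if f: "f \<in> ?F" for f
  proof -
    have "(\<Sum>y\<in>T. \<Sum>z\<in>T. (h y - h z) * (f y - f z) * \<mu> y z)
        = 2 * (\<Sum>y\<in>B. f y * (vertex_weight \<mu> y * (h y - avg h y)))"
      using fT f by (intro summation_by_parts) (auto simp: T_def)
    also have "(\<Sum>y\<in>B. f y * (vertex_weight \<mu> y * (h y - avg h y)))
        = (\<Sum>y\<in>B. if y = x then c else 0)"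
    proof (intro sum.cong refl)
      fix y assume y: "y \<in> B"
      have "h y = (if y = x then 1 else avg h y)"
        unfolding h_def using y by (subst hitting_eq) simp
      then show "f y * (vertex_weight \<mu> y * (h y - avg h y)) = (if y = x then c else 0)"
        using f by (auto simp: c_def escape_def h_def B_def)
    qed
    also have "\<dots> = c" using xB finite_ball by (simp add: B_def)
    finally show ?thesis .
  qed
  have hF: "h \<in> ?F" using xB by (auto simp: h_def hitting_eq)
  have eh: "energy adj \<mu> h = ennreal c"
    using form[OF hF] by (simp add: en[OF hF] power2_eq_square)
  have "ennreal c \<le> energy adj \<mu> f" if f: "f \<in> ?F" for f
  proof -
    \<comment> \<open>This is nonnegativity of the energy of \<open>f - h\<close>, expanded;
      \<open>form\<close> evaluates the cross term and the energy of \<open>h\<close>.\<close>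
    have "2 * (\<Sum>y\<in>T. \<Sum>z\<in>T. (h y - h z) * (f y - f z) * \<mu> y z)
        - (\<Sum>y\<in>T. \<Sum>z\<in>T. (h y - h z) * (h y - h z) * \<mu> y z)
      \<le> (\<Sum>y\<in>T. \<Sum>z\<in>T. (f y - f z)\<^sup>2 * \<mu> y z)"
      unfolding sum_distrib_left sum_subtractf[symmetric]
    proof (intro sum_mono)
      fix y z
      have "0 \<le> ((f y - f z) - (h y - h z))\<^sup>2 * \<mu> y z" by (simp add: weight_nonneg)
      then show "2 * ((h y - h z) * (f y - f z) * \<mu> y z) - (h y - h z) * (h y - h z) * \<mu> y z
          \<le> (f y - f z)\<^sup>2 * \<mu> y z"
        by (simp add: power2_eq_square algebra_simps)
    qed
    then show ?thesis unfolding en[OF f] form[OF f] form[OF hF] by (intro ennreal_leI) simp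
  qed
  then have "(INF f\<in>?F. energy adj \<mu> f) = ennreal c"
    using eh hF by (intro antisym INF_greatest INF_lower2[OF hF]) auto
  then show ?thesis
    by (simp add: resistance_ball_def eff_resistance_def B_def c_def)
qed

section \<open>Infinite radius and uniformity under condition (U)\<close>

definition escape_inf :: "'a \<Rightarrow> real" where
  "escape_inf x = (INF m. escape x m)"

lemma bdd_escape: "bdd_below (range (escape x))"
  using escape_nonneg by (intro bdd_belowI[of _ 0]) auto

lemma tendsto_escape: "escape x \<longlonglongrightarrow> escape_inf x"
  unfolding escape_inf_def
  by (intro LIMSEQ_decseq_INF bdd_escape) (auto simp: decseq_def escape_antimono)

lemma escape_inf_le: "escape_inf x \<le> escape x m"
  unfolding escape_inf_def by (intro cINF_lower bdd_escape) auto

lemma escape_inf_nonneg: "0 \<le> escape_inf x"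
  unfolding escape_inf_def by (intro cINF_greatest escape_nonneg) auto

text \<open>Inversion is continuous on all of \<open>ennreal\<close>, so vanishing
  \<open>escape_inf x\<close> is covered, with infinite resistance. The ball formula is used for
  positive radii only.\<close>

lemma resistance_inf_eq:
  "resistance_inf adj \<mu> x = inverse (ennreal (vertex_weight \<mu> x * escape_inf x))"
  unfolding resistance_inf_def
proof (rule limI)
  have "(\<lambda>m. ennreal (vertex_weight \<mu> x * escape x m))
      \<longlonglongrightarrow> ennreal (vertex_weight \<mu> x * escape_inf x)"
    by (intro tendsto_ennrealI tendsto_mult_left tendsto_escape)
  from continuous_on_tendsto_compose[OF continuous_on_inverse_ennreal[OF continuous_on_id[of UNIV]] this]
  have "(\<lambda>m. inverse (ennreal (vertex_weight \<mu> x * escape x m)))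
      \<longlonglongrightarrow> inverse (ennreal (vertex_weight \<mu> x * escape_inf x))" by simp
  moreover have "\<forall>\<^sub>F m in sequentially. inverse (ennreal (vertex_weight \<mu> x * escape x m))
      = resistance_ball adj \<mu> x m"
    using eventually_gt_at_top[of 0] by eventually_elim (simp add: resistance_ball_eq)
  ultimately show "resistance_ball adj \<mu> x \<longlonglongrightarrow> inverse (ennreal (vertex_weight \<mu> x * escape_inf x))"
    by (rule Lim_transform_eventually)
qed

text \<open>The conjunct of \<open>condition_U\<close> to apply is chosen at each vertex by whether
  \<open>escape_inf x\<close> vanishes. Bounds on vertex weights carry uniformity from resistances
  to their reciprocals.\<close>

lemma escape_uniform:
  assumes "condition_U adj \<mu>" and \<delta>: "\<delta> > 0"
  obtains m where "\<And>x. escape x m \<le> escape_inf x + \<delta>"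
proof -
  obtain W where W: "W > 0" "\<And>x. vertex_weight \<mu> x \<le> W" by (rule vertex_weight_bounded) blast
  obtain w where w: "w > 0" "\<And>x. w \<le> vertex_weight \<mu> x"
    by (rule vertex_weight_bounded_below) blast
  have "\<forall>\<^sub>F m in sequentially. \<forall>x\<in>{x. resistance_inf adj \<mu> x < \<infinity>}.
      dist (enn2real (resistance_ball adj \<mu> x m)) (enn2real (resistance_inf adj \<mu> x)) < \<delta> / W"
    using assms W unfolding condition_U_def by (intro uniform_limitD) auto
  moreover have "\<forall>\<^sub>F m in sequentially. ennreal (1 / (w * \<delta>))
      < (INF x\<in>{x. resistance_inf adj \<mu> x = \<infinity>}. resistance_ball adj \<mu> x m)"
    using assms unfolding condition_U_def by (intro order_tendstoD(1)) auto
  ultimately have "\<forall>\<^sub>F m in sequentially. \<forall>x. escape x m \<le> escape_inf x + \<delta>"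
    using eventually_gt_at_top[of 0]
  proof eventually_elim
    case (elim m)
    show ?case
    proof
      fix x
      let ?v = "vertex_weight \<mu> x"
      have v: "?v > 0" by (rule vertex_weight_pos)
      show "escape x m \<le> escape_inf x + \<delta>"
      proof (cases "escape_inf x = 0")
        case True
        then have "resistance_inf adj \<mu> x = \<infinity>" by (simp add: resistance_inf_eq)
        then have "(INF x\<in>{x. resistance_inf adj \<mu> x = \<infinity>}. resistance_ball adj \<mu> x m)
          \<le> resistance_ball adj \<mu> x m" by (intro INF_lower) simp
        with elim have lt: "ennreal (1 / (w * \<delta>)) < inverse (ennreal (?v * escape x m))"
          using resistance_ball_eq[of m x] by simp
        show ?thesis
        proof (cases "escape x m = 0")
          case False
          then have e: "escape x m > 0" using escape_nonneg[of x m] by linarith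
          with lt v have "1 / (w * \<delta>) < inverse (?v * escape x m)"
            using w \<delta> by (simp add: inverse_ennreal ennreal_less_iff)
          \<comment> \<open>The threshold \<open>1 / (w * \<delta>)\<close> for the resistance was
            chosen to give this.\<close>
          then have "?v * escape x m < w * \<delta>"
            using v e w \<delta> by (simp add: field_simps)
          also have "\<dots> \<le> ?v * \<delta>" using w \<delta> by simp
          finally show ?thesis using v True by simp
        qed (use True \<delta> in simp)
      next
        case False
        then have ei: "escape_inf x > 0" using escape_inf_nonneg[of x] by linarith
        then have e: "escape x m > 0" using escape_inf_le[of x m] by linarith
        have "resistance_inf adj \<mu> x < \<infinity>"
          using ei v by (simp add: resistance_inf_eq inverse_ennreal)
        with elim(1) have "dist (enn2real (resistance_ball adj \<mu> x m))
            (enn2real (resistance_inf adj \<mu> x)) < \<delta> / W" by blast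
        then have "\<bar>inverse (?v * escape x m) - inverse (?v * escape_inf x)\<bar> < \<delta> / W"
          using elim(3) ei e v
          by (simp add: resistance_inf_eq resistance_ball_eq inverse_ennreal dist_real_def)
        then have *: "inverse (?v * escape_inf x) - inverse (?v * escape x m) < \<delta> / W" by linarith
        \<comment> \<open>The factor relating both differences is at most \<open>W\<close>, which is
          why the resistances were taken within \<open>\<delta> / W\<close>.\<close>
        have "escape x m - escape_inf x
          = (inverse (?v * escape_inf x) - inverse (?v * escape x m))
             * (?v * (escape x m * escape_inf x))"
          using ei e v by (simp add: field_simps)
        also have "\<dots> \<le> \<delta> / W * (?v * (escape x m * escape_inf x))"
          using * ei e v by (intro mult_right_mono) auto
        also have "\<dots> \<le> \<delta> / W * (W * (1 * 1))"
          using W \<delta> e ei v escape_le_1[of x m] escape_inf_le[of x m]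
          by (intro mult_left_mono mult_mono) auto
        also have "\<dots> = \<delta>" using W by simp
        finally show ?thesis by simp
      qed
    qed
  qed
  then show ?thesis using that by (auto simp: eventually_sequentially)
qed

text \<open>Any return probability is at most \<open>1 - escape_inf x\<close>, hence almost at most
  \<open>1 - escape x k\<close>, and by a suitable time \<open>m\<close> almost all of the latter
  has been realised.\<close>

lemma ret_uniform:
  assumes "condition_U adj \<mu>" and "\<delta> > 0"
  obtains m where "\<And>n x. ret n x \<le> ret m x + \<delta>"
proof -
  obtain k where k: "\<And>x. escape x k \<le> escape_inf x + \<delta> / 2"
    using escape_uniform[OF assms(1), of "\<delta> / 2"] assms(2) by auto
  obtain m where m: "\<And>x. 1 - ret m x \<le> escape x k + \<delta> / 2"
    using no_return_le_escape[of "\<delta> / 2" k] assms(2) by auto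
  have "ret n x \<le> ret m x + \<delta>" for n x
    using k[of x] m[of x] ret_le_escape[of n x] escape_inf_le[of x n] by linarith
  then show ?thesis by (rule that)
qed

subsection \<open>Finite trajectories and exponential tails\<close>

definition step :: "'a \<Rightarrow> 'a pmf" where
  "step x = embed_pmf (\<lambda>y. \<mu> x y / vertex_weight \<mu> x)"

lemma pmf_step: "pmf (step x) y = \<mu> x y / vertex_weight \<mu> x"
  unfolding step_def
proof (rule pmf_embed_pmf)
  have "(\<integral>\<^sup>+y. ennreal (\<mu> x y / vertex_weight \<mu> x) \<partial>count_space UNIV)
      = (\<Sum>y | adj x y. ennreal (\<mu> x y / vertex_weight \<mu> x))"
    by (rule nn_integral_count_space'[OF finite_degree]) (auto simp: weight_eq_0)
  also have "\<dots> = ennreal (\<Sum>y | adj x y. \<mu> x y / vertex_weight \<mu> x)"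
    using vertex_weight_pos[of x] weight_nonneg by (intro sum_ennreal) auto
  also have "(\<Sum>y | adj x y. \<mu> x y / vertex_weight \<mu> x) = 1"
    using avg_const[of 1 x] by (simp add: avg_def)
  finally show "(\<integral>\<^sup>+y. ennreal (\<mu> x y / vertex_weight \<mu> x) \<partial>count_space UNIV) = 1" by simp
qed (use vertex_weight_pos[of x] weight_nonneg in auto)

lemma set_pmf_step: "set_pmf (step x) = {y. adj x y}"
  using weight_pos_iff vertex_weight_pos[of x] weight_eq_0
  by (force simp: set_pmf_iff pmf_step)

text \<open>The law of the list \<open>[S\<^sub>0, \<dots>, S\<^sub>n\<^sub>-\<^sub>1]\<close> of length \<open>n\<close>, without \<open>S\<^sub>n\<close>.\<close>

primrec path :: "nat \<Rightarrow> 'a \<Rightarrow> 'a list pmf" where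
  "path 0 x = return_pmf []"
| "path (Suc n) x = bind_pmf (step x) (\<lambda>y. map_pmf (Cons x) (path n y))"

text \<open>The law of \<open>[S\<^sub>1, \<dots>, S\<^sub>n]\<close> for the walk started at \<open>x\<close>.\<close>

abbreviation future :: "nat \<Rightarrow> 'a \<Rightarrow> 'a list pmf" where
  "future n x \<equiv> bind_pmf (step x) (path n)"

lemma path_Suc: "path (Suc n) x = map_pmf (Cons x) (future n x)"
  by (simp add: map_bind_pmf)

lemma finite_set_path: "finite (set_pmf (path n x))"
  by (induction n arbitrary: x) (auto simp: set_pmf_step finite_degree)

lemma finite_set_future: "finite (set_pmf (future n x))"
  by (auto simp: set_pmf_step finite_degree finite_set_path)

lemma length_path: "xs \<in> set_pmf (path n x) \<Longrightarrow> length xs = n"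
  by (induction n arbitrary: x xs) auto

lemma integrable_path [simp]:
  fixes f :: "'a list \<Rightarrow> real" shows "integrable (measure_pmf (path n x)) f"
  by (intro integrable_measure_pmf_finite finite_set_path)

lemma integrable_future [simp]:
  fixes f :: "'a list \<Rightarrow> real" shows "integrable (measure_pmf (future n x)) f"
  by (intro integrable_measure_pmf_finite finite_set_future)

abbreviation E where "E \<equiv> \<lambda>n x f. measure_pmf.expectation (path n x) (f :: 'a list \<Rightarrow> real)"

lemma expectation_future:
  fixes f :: "'a list \<Rightarrow> real"
  shows "measure_pmf.expectation (future n x) f = avg (\<lambda>y. E n y f) x"
  by (subst pmf_expectation_bind[OF finite_degree[of x]])
    (auto simp: set_pmf_step finite_set_path avg_def pmf_step)

lemma E_Suc: "E (Suc n) x f = avg (\<lambda>y. E n y (\<lambda>xs. f (x # xs))) x"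
  unfolding path_Suc integral_map_pmf by (rule expectation_future)

lemma prob_eq_E: "measure_pmf.prob (path n x) A = E n x (indicator A)"
  by simp

lemma prob_path_visit: "measure_pmf.prob (path n y) {xs. x \<in> set xs} = hit UNIV x n y"
  unfolding prob_eq_E
proof (induction n arbitrary: y)
  case (Suc n)
  have "indicator {xs. x \<in> set xs} (y # xs) = (if y = x then 1 else indicator {xs. x \<in> set xs} xs :: real)"
    for xs by (auto simp: indicator_def)
  then show ?case using Suc avg_const[of 1 x] unfolding E_Suc by (cases "y = x") auto
qed simp

lemma prob_future_visit: "measure_pmf.prob (future n x) {xs. x \<in> set xs} = ret n x"
proof -
  have "measure_pmf.prob (future n x) {xs. x \<in> set xs}
    = measure_pmf.expectation (future n x) (indicator {xs. x \<in> set xs})" by simp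
  then show ?thesis
    unfolding expectation_future prob_eq_E[symmetric] prob_path_visit ret_def .
qed

lemma map_take_path: "map_pmf (take m) (path n x) = path (min m n) x"
proof (induction n arbitrary: m x)
  case (Suc n)
  show ?case
  proof (cases m)
    case (Suc k)
    have "map_pmf (take m) (path (Suc n) x)
      = bind_pmf (step x) (\<lambda>y. map_pmf (Cons x) (map_pmf (take k) (path n y)))"
      by (simp add: map_bind_pmf pmf.map_comp o_def Suc)
    then show ?thesis using Suc by (simp add: Suc.IH)
  qed (simp add: map_pmf_const)
qed simp

lemma prob_future_visit_take:
  "measure_pmf.prob (future n x) {xs. x \<in> set (take m xs)} = ret (min m n) x"
proof -
  have "future (min m n) x = map_pmf (take m) (future n x)"
    by (simp add: map_bind_pmf map_take_path)
  then show ?thesis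
    by (simp add: vimage_def flip: prob_future_visit)
qed

text \<open>Linearity of expectation and the Markov property; positions are indexed by the number
  \<open>k\<close> of entries after them.\<close>

lemma E_tail_count_le:
  assumes "\<And>k x. measure_pmf.prob (future k x) {xs. Q x xs} \<le> q k"
  shows "E n x (\<lambda>xs. real (tail_count Q xs)) \<le> (\<Sum>k<n. q k)"
proof (induction n arbitrary: x)
  case (Suc n)
  have "E (Suc n) x (\<lambda>xs. real (tail_count Q xs))
    = measure_pmf.expectation (future n x) (\<lambda>xs. indicator {xs. Q x xs} xs + real (tail_count Q xs))"
    unfolding path_Suc integral_map_pmf
    by (intro Bochner_Integration.integral_cong) (auto simp: indicator_def)
  also have "\<dots> = measure_pmf.prob (future n x) {xs. Q x xs}
      + avg (\<lambda>y. E n y (\<lambda>xs. real (tail_count Q xs))) x"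
    by (simp add: expectation_future[symmetric])
  also have "\<dots> \<le> q n + (\<Sum>k<n. q k)"
    using Suc assms by (intro add_mono avg_le)
  finally show ?case by simp
qed simp

text \<open>Markov property at time \<open>m\<close>, with a bound on the remainder uniform in its
  start. The induction absorbs the first entry into \<open>F\<close>.\<close>

lemma E_split_le:
  assumes "\<And>y. E n y G \<le> c" and "\<And>xs. 0 \<le> F xs"
  shows "E (m + n) x (\<lambda>xs. F (take m xs) * G (drop m xs)) \<le> E m x F * c"
  using assms(2)
proof (induction m arbitrary: x F)
  case 0
  then show ?case using assms(1) by (simp add: mult_left_mono)
next
  case (Suc m)
  have "E (Suc m + n) x (\<lambda>xs. F (take (Suc m) xs) * G (drop (Suc m) xs))
    = avg (\<lambda>y. E (m + n) y (\<lambda>xs. F (x # take m xs) * G (drop m xs))) x"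
    unfolding add_Suc E_Suc by simp
  also have "\<dots> \<le> avg (\<lambda>y. c * E m y (\<lambda>xs. F (x # xs))) x"
    using Suc.IH[of "\<lambda>xs. F (x # xs)"] Suc.prems by (intro avg_mono) (simp add: mult.commute)
  also have "\<dots> = E (Suc m) x F * c"
    unfolding avg_cmult E_Suc by simp
  finally show ?case .
qed

section \<open>Exponential moments by cutting into blocks\<close>

text \<open>Near-subadditivity turns the exponential into a product over \<open>k\<close> blocks of
  length \<open>L\<close>, each joint costing \<open>M\<close>; the remaining \<open>r\<close>
  entries are bounded by their number.\<close>

lemma exp_moment_le:
  fixes X :: "'a list \<Rightarrow> real"
  assumes X0: "\<And>xs. 0 \<le> X xs" "\<And>xs. X xs \<le> length xs"
    and sub: "\<And>xs ys. X (xs @ ys) \<le> X xs + M + X ys"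
    and mean: "\<And>x. E L x X \<le> a"
    and t: "0 < t" "t * real L \<le> 1"
  shows "E (k * L + r) x (\<lambda>xs. exp (t * X xs))
    \<le> exp (real k * (t * (a + M) + (t * real L)\<^sup>2)) * exp (t * real r)"
proof (induction k arbitrary: x)
  case 0
  have "E r x (\<lambda>xs. exp (t * X xs)) \<le> E r x (\<lambda>_. exp (t * real r))"
    using X0(2) t by (intro integral_mono_AE AE_pmfI) (auto dest!: length_path)
  then show ?case by simp
next
  case (Suc k)
  let ?c = "exp (real k * (t * (a + M) + (t * real L)\<^sup>2)) * exp (t * real r)"
  have "E L x (\<lambda>xs. exp (t * X xs)) \<le> E L x (\<lambda>xs. 1 + t * X xs + (t * real L)\<^sup>2)"
  proof (intro integral_mono_AE AE_pmfI)
    fix xs assume "xs \<in> set_pmf (path L x)"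
    then have XL: "X xs \<le> real L" using X0(2)[of xs] length_path by simp
    then have le: "t * X xs \<le> t * real L" using t by simp
    \<comment> \<open>The quadratic bound on the exponential holds on \<open>[0, 1]\<close>, whence
      the assumption \<open>t * real L \<le> 1\<close>.\<close>
    have "exp (t * X xs) \<le> 1 + t * X xs + (t * X xs)\<^sup>2"
      using le t X0(1)[of xs] by (intro exp_bound mult_nonneg_nonneg) linarith+
    also have "(t * X xs)\<^sup>2 \<le> (t * real L)\<^sup>2"
      using le t X0(1)[of xs] by (intro power_mono) auto
    finally show "exp (t * X xs) \<le> 1 + t * X xs + (t * real L)\<^sup>2" by simp
  qed simp_all
  also have "\<dots> = 1 + t * E L x X + (t * real L)\<^sup>2" by simp
  also have "\<dots> \<le> 1 + (t * a + (t * real L)\<^sup>2)" using mean t by simp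
  also have "\<dots> \<le> exp (t * a + (t * real L)\<^sup>2)" by (rule exp_ge_add_one_self)
  finally have one: "E L x (\<lambda>xs. exp (t * X xs)) \<le> exp (t * a + (t * real L)\<^sup>2)" .
  have "E (Suc k * L + r) x (\<lambda>xs. exp (t * X xs))
    \<le> E (L + (k * L + r)) x (\<lambda>xs. (exp (t * M) * exp (t * X (take L xs))) * exp (t * X (drop L xs)))"
    unfolding mult_Suc add.assoc
  proof (intro integral_mono_AE AE_pmfI)
    fix xs
    have "t * X xs \<le> t * (X (take L xs) + M + X (drop L xs))"
      using sub[of "take L xs" "drop L xs"] t by simp
    then show "exp (t * X xs) \<le> (exp (t * M) * exp (t * X (take L xs))) * exp (t * X (drop L xs))"
      by (simp add: exp_add[symmetric] algebra_simps)
  qed simp_all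
  also have "\<dots> \<le> E L x (\<lambda>xs. exp (t * M) * exp (t * X xs)) * ?c"
    using Suc by (intro E_split_le) auto
  also have "\<dots> = exp (t * M) * E L x (\<lambda>xs. exp (t * X xs)) * ?c" by simp
  also have "\<dots> \<le> exp (t * M) * exp (t * a + (t * real L)\<^sup>2) * ?c"
    using one by (intro mult_right_mono mult_left_mono) auto
  also have "\<dots> = exp (real (Suc k) * (t * (a + M) + (t * real L)\<^sup>2)) * exp (t * real r)"
    by (simp add: exp_add[symmetric] algebra_simps)
  finally show ?case .
qed

text \<open>Chernoff bound: long blocks make \<open>b + M\<close> negligible per step, and small
  \<open>t\<close> makes the quadratic term negligible against the linear one. Each may cost
  \<open>\<epsilon> / 4\<close>, leaving \<open>\<epsilon> / 2\<close> for the decay.\<close>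

lemma exponential_tail:
  fixes X :: "'a list \<Rightarrow> real"
  assumes X0: "\<And>xs. 0 \<le> X xs" "\<And>xs. X xs \<le> length xs"
    and sub: "\<And>xs ys. X (xs @ ys) \<le> X xs + M + X ys"
    and mean: "\<And>n x. E n x X \<le> real n * q + b"
    and q: "0 \<le> q" and \<epsilon>: "0 < \<epsilon>"
  obtains C c where "C > 0" "c > 0"
    "\<And>n x. measure_pmf.prob (path n x) {xs. X xs \<ge> real n * (q + \<epsilon>)} \<le> C * exp (- c * real n)"
proof -
  obtain L0 :: nat where L0: "4 * (b + M) / \<epsilon> < real L0" using reals_Archimedean2 by blast
  define L where "L = Suc L0"
  define t where "t = min 1 (\<epsilon> / 4) / real L"
  have L: "b + M \<le> real L * \<epsilon> / 4" "L > 0"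
    using L0 \<epsilon> by (auto simp: L_def field_simps)
  have t: "t > 0" "t * real L \<le> 1" "t * real L \<le> \<epsilon> / 4"
    using \<epsilon> by (auto simp: t_def L_def)
  have rate: "t * ((real L * q + b) + M) + (t * real L)\<^sup>2 \<le> t * real L * (q + \<epsilon> / 2)"
  proof -
    have "t * (b + M) \<le> t * (real L * \<epsilon> / 4)" using L t by simp
    moreover have "(t * real L)\<^sup>2 \<le> t * real L * (\<epsilon> / 4)"
      unfolding power2_eq_square using t by (intro mult_left_mono) auto
    ultimately show ?thesis by (simp add: algebra_simps)
  qed
  have "measure_pmf.prob (path n x) {xs. X xs \<ge> real n * (q + \<epsilon>)}
      \<le> exp (t * real L) * exp (- (t * \<epsilon> / 2) * real n)" for n x
  proof -
    define k r where "k = n div L" and "r = n mod L"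
    have n: "n = k * L + r" by (simp add: k_def r_def)
    have r: "r < L" using L by (simp add: r_def)
    have "{xs. X xs \<ge> real n * (q + \<epsilon>)}
        = {xs \<in> space (measure_pmf (path n x)). exp (t * X xs) \<ge> exp (t * (real n * (q + \<epsilon>)))}"
      using t by simp
    also have "measure_pmf.prob (path n x) \<dots>
        \<le> E n x (\<lambda>xs. exp (t * X xs)) / exp (t * (real n * (q + \<epsilon>)))"
      by (rule integral_Markov_inequality_measure[where A = "{}"]) auto
    also have "\<dots> \<le> exp (real k * (t * ((real L * q + b) + M) + (t * real L)\<^sup>2)) * exp (t * real r)
        / exp (t * (real n * (q + \<epsilon>)))"
      unfolding n using X0 sub mean t by (intro divide_right_mono exp_moment_le) auto
    also have "\<dots> \<le> exp (real k * (t * real L * (q + \<epsilon> / 2))) * exp (t * real L)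
        / exp (t * (real n * (q + \<epsilon>)))"
      using rate t r by (intro divide_right_mono mult_mono) (auto intro: mult_left_mono)
    also have "\<dots> \<le> exp (t * real n * (q + \<epsilon> / 2)) * exp (t * real L) / exp (t * (real n * (q + \<epsilon>)))"
    proof (intro divide_right_mono mult_right_mono)
      \<comment> \<open>As \<open>q\<close> is nonnegative, replacing \<open>k * L\<close> by
        \<open>n\<close> only enlarges the exponent.\<close>
      have "real k * real L \<le> real n" unfolding n by simp
      then have "(real k * real L) * (t * (q + \<epsilon> / 2)) \<le> real n * (t * (q + \<epsilon> / 2))"
        using t q \<epsilon> by (intro mult_right_mono) auto
      then show "exp (real k * (t * real L * (q + \<epsilon> / 2))) \<le> exp (t * real n * (q + \<epsilon> / 2))"
        by (simp add: mult_ac)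
    qed auto
    also have "\<dots> = exp (t * real L) * exp (- (t * \<epsilon> / 2) * real n)"
      by (simp add: exp_add[symmetric] exp_diff[symmetric] algebra_simps)
    finally show ?thesis .
  qed
  moreover have "t * \<epsilon> / 2 > 0" using t \<epsilon> by simp
  ultimately show ?thesis using that[of "exp (t * real L)" "t * \<epsilon> / 2"] by simp
qed

subsection \<open>The law of the walk\<close>

text \<open>\<open>path\<close> grows at the front, whereas the assumption \<open>markov\<close>
  extends a history at its end.\<close>

lemma path_Suc_back:
  "path (Suc (Suc n)) x = bind_pmf (path (Suc n) x) (\<lambda>xs. map_pmf (\<lambda>y. xs @ [y]) (step (last xs)))"
proof (induction n arbitrary: x)
  case 0
  show ?case by (simp add: map_bind_pmf bind_map_pmf bind_assoc_pmf bind_return_pmf map_pmf_def)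
next
  case (Suc n)
  have "path (Suc (Suc (Suc n))) x = bind_pmf (step x) (\<lambda>z. map_pmf (Cons x)
      (bind_pmf (path (Suc n) z) (\<lambda>xs. map_pmf (\<lambda>y. xs @ [y]) (step (last xs)))))"
    unfolding Suc.IH[symmetric] by simp
  also have "\<dots> = bind_pmf (step x) (\<lambda>z. bind_pmf (path (Suc n) z)
      (\<lambda>xs. map_pmf (\<lambda>y. (x # xs) @ [y]) (step (last (x # xs)))))"
    by (intro bind_pmf_cong refl)
      (auto simp: map_bind_pmf pmf.map_comp o_def dest!: length_path intro!: bind_pmf_cong)
  also have "\<dots> = bind_pmf (path (Suc (Suc n)) x) (\<lambda>xs. map_pmf (\<lambda>y. xs @ [y]) (step (last xs)))"
    by (simp only: path.simps(2)[of "Suc n"] bind_assoc_pmf bind_map_pmf)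
  finally show ?case .
qed

lemma pmf_path_snoc:
  assumes "length xs = Suc n"
  shows "pmf (path (Suc (Suc n)) x) (xs @ [y]) = pmf (path (Suc n) x) xs * (\<mu> (last xs) y / vertex_weight \<mu> (last xs))"
proof -
  let ?c = "\<mu> (last xs) y / vertex_weight \<mu> (last xs)"
  have *: "pmf (map_pmf (\<lambda>y. zs @ [y]) (step (last zs))) (xs @ [y]) = indicator {xs} zs * ?c" for zs
  proof (cases "zs = xs")
    case True
    have "pmf (map_pmf (\<lambda>y. xs @ [y]) (step (last xs))) (xs @ [y]) = pmf (step (last xs)) y"
      by (rule pmf_map_inj') (simp add: inj_def)
    then show ?thesis using True by (simp add: pmf_step)
  next
    case False
    then show ?thesis by (auto simp: pmf_eq_0_set_pmf)
  qed
  show ?thesis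
    unfolding path_Suc_back pmf_bind * by (simp add: measure_pmf_single del: path.simps)
qed

end

context random_walk
begin

abbreviation traj :: "nat \<Rightarrow> 'w \<Rightarrow> 'a list" where
  "traj n \<omega> \<equiv> map (\<lambda>i. S i \<omega>) [0..<n]"

text \<open>Prepending a random head is measurable because heads range over a countable set.\<close>

lemma measurable_map_chain: "(\<lambda>\<omega>. map (\<lambda>i. S i \<omega>) is) \<in> measurable (P x) (count_space UNIV)"
proof (induction "is")
  case (Cons i "is")
  have "(\<lambda>\<omega>. a # map (\<lambda>i. S i \<omega>) is) \<in> measurable (P x) (count_space UNIV)" for a
    by (rule measurable_compose[OF Cons]) simp
  then show ?case
    using measurable_compose_countable'[OF _ measurable_chain countable_vertices,
        where f = "\<lambda>a \<omega>. a # map (\<lambda>i. S i \<omega>) is"] by simp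
qed simp

lemma traj_event [measurable]: "{\<omega> \<in> space (P x). Q (traj n \<omega>)} \<in> sets (P x)"
  using measurable_sets[OF measurable_map_chain, of "{xs. Q xs}"]
  by (simp add: vimage_def Int_def conj_commute)

lemma prob_traj_eq: "\<P>(\<omega> in P x. traj (Suc n) \<omega> = xs) = pmf (path (Suc n) x) xs"
proof (induction n arbitrary: xs)
  case 0
  interpret prob_space "P x" by (rule prob_space_law)
  show ?case
  proof (cases "xs = [x]")
    case True
    have "AE \<omega> in P x. traj (Suc 0) \<omega> = xs" using start[of x] True by auto
    then have "\<P>(\<omega> in P x. traj (Suc 0) \<omega> = xs) = 1" by (intro prob_Collect_eq_1[THEN iffD2] traj_event)
    then show ?thesis using True by (simp add: map_pmf_const)
  next
    case False
    have "AE \<omega> in P x. traj (Suc 0) \<omega> \<noteq> xs" using start[of x] False by auto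
    then have "\<P>(\<omega> in P x. traj (Suc 0) \<omega> = xs) = 0" by (intro prob_Collect_eq_0[THEN iffD2] traj_event)
    then show ?thesis using False by (simp add: map_pmf_const)
  qed
next
  case (Suc n)
  interpret prob_space "P x" by (rule prob_space_law)
  show ?case
  proof (cases "length xs = Suc (Suc n)")
    case False
    then have "\<P>(\<omega> in P x. traj (Suc (Suc n)) \<omega> = xs) = measure (P x) {}"
      by (intro arg_cong[where f = "measure (P x)"]) auto
    moreover have "pmf (path (Suc (Suc n)) x) xs = 0"
      using False length_path by (auto simp: pmf_eq_0_set_pmf simp del: path.simps)
    ultimately show ?thesis by (simp del: path.simps)
  next
    case True
    then obtain ys y where xs: "xs = ys @ [y]" "length ys = Suc n"
      by (cases xs rule: rev_cases) auto
    have hist: "(\<forall>i\<le>n. S i \<omega> = ys ! i) \<longleftrightarrow> traj (Suc n) \<omega> = ys" for \<omega>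
      using xs(2) by (auto simp: list_eq_iff_nth_eq less_Suc_eq_le simp del: upt_Suc)
    have full: "traj (Suc (Suc n)) \<omega> = xs \<longleftrightarrow> S (Suc n) \<omega> = y \<and> traj (Suc n) \<omega> = ys" for \<omega>
      using xs by auto
    have yn: "ys ! n = last ys" using xs(2) by (cases ys rule: rev_cases) auto
    let ?H = "\<P>(\<omega> in P x. traj (Suc n) \<omega> = ys)"
    have "\<P>(\<omega> in P x. traj (Suc (Suc n)) \<omega> = xs) = ?H * (\<mu> (last ys) y / vertex_weight \<mu> (last ys))"
    \<comment> \<open>\<open>markov\<close> speaks only of histories of positive probability;
      extensions of a null history are null.\<close>
    proof (cases "?H = 0")
      case True
      have "\<P>(\<omega> in P x. traj (Suc (Suc n)) \<omega> = xs) \<le> ?H"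
        unfolding full by (intro finite_measure_mono traj_event) auto
      then show ?thesis using True by (simp add: measure_le_0_iff del: upt_Suc)
    next
      case False
      then have "0 < ?H" by (simp add: zero_less_measure_iff del: upt_Suc)
      then have "\<P>(\<omega> in P x. S (Suc n) \<omega> = y \<bar> \<forall>i\<le>n. S i \<omega> = ys ! i)
          = \<mu> (ys ! n) y / vertex_weight \<mu> (ys ! n)"
        by (intro markov) (simp only: hist)
      then show ?thesis
        using False unfolding cond_prob_def hist full yn by (simp add: field_simps del: upt_Suc)
    qed
    then show ?thesis
      unfolding Suc xs(1) pmf_path_snoc[OF xs(2)] .
  qed
qed

lemma distr_traj: "distr (P x) (count_space UNIV) (traj n) = measure_pmf (path n x)"
proof (cases n)
  case 0
  interpret prob_space "P x" by (rule prob_space_law)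
  show ?thesis unfolding 0
    by (rule measure_eqI) (auto simp: emeasure_distr measurable_map_chain emeasure_space_1 indicator_def)
next
  case (Suc m)
  interpret prob_space "P x" by (rule prob_space_law)
  show ?thesis
  proof (rule measure_eqI_countable[of _ "UNIV :: 'a list set"])
    show "countable (UNIV :: 'a list set)"
      using countable_lists[OF countable_vertices] by simp
    fix xs :: "'a list"
    have "emeasure (distr (P x) (count_space UNIV) (traj n)) {xs} = emeasure (P x) {\<omega>\<in>space (P x). traj n \<omega> = xs}"
      by (simp add: emeasure_distr measurable_map_chain vimage_def Int_def conj_commute)
    then show "emeasure (distr (P x) (count_space UNIV) (traj n)) {xs} = emeasure (measure_pmf (path n x)) {xs}"
      unfolding Suc by (simp add: emeasure_eq_measure prob_traj_eq emeasure_pmf_single del: path.simps upt_Suc)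
  qed auto
qed

lemma prob_traj: "\<P>(\<omega> in P x. Q (traj n \<omega>)) = measure_pmf.prob (path n x) {xs. Q xs}"
  unfolding distr_traj[symmetric]
  by (subst measure_distr) (auto simp: measurable_map_chain vimage_def Int_def conj_commute)

lemma range_size_eq: "range_size S n \<omega> = card (set (traj n \<omega>))"
  by (simp add: range_size_def atLeast0LessThan)

lemma return_time_less_iff: "return_time S x \<omega> < \<infinity> \<longleftrightarrow> (\<exists>n\<ge>1. S n \<omega> = x)"
proof
  assume "return_time S x \<omega> < \<infinity>"
  then have "{n. 1 \<le> n \<and> S n \<omega> = x} \<noteq> {}"
    unfolding return_time_def by (metis INF_empty less_irrefl top_enat_def)
  then show "\<exists>n\<ge>1. S n \<omega> = x" by auto
next
  assume "\<exists>n\<ge>1. S n \<omega> = x"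
  then obtain n where "1 \<le> n" "S n \<omega> = x" by blast
  then have "return_time S x \<omega> \<le> enat n"
    unfolding return_time_def by (intro INF_lower) auto
  then show "return_time S x \<omega> < \<infinity>" by (rule le_less_trans) simp
qed

text \<open>\<open>tl\<close> discards time 0, which does not count as a return.\<close>

lemma return_by_iff:
  "(\<exists>i\<in>{1..n}. S i \<omega> = x) \<longleftrightarrow> x \<in> set (tl (traj (Suc n) \<omega>))"
  by (auto simp: upt_conv_Cons atLeastLessThanSuc_atLeastAtMost simp del: upt_Suc)

lemma prob_return_by: "\<P>(\<omega> in P x. \<exists>i\<in>{1..n}. S i \<omega> = x) = ret n x"
proof -
  have "\<P>(\<omega> in P x. \<exists>i\<in>{1..n}. S i \<omega> = x)
      = measure_pmf.prob (path (Suc n) x) {xs. x \<in> set (tl xs)}"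
    unfolding return_by_iff by (rule prob_traj)
  then show ?thesis
    unfolding path_Suc by (simp add: vimage_def prob_future_visit)
qed

text \<open>Continuity from below along the increasing events of a return by time
  \<open>n\<close>.\<close>

lemma tendsto_ret: "(\<lambda>n. ret n x) \<longlonglongrightarrow> return_prob P S x"
proof -
  interpret prob_space "P x" by (rule prob_space_law)
  let ?A = "\<lambda>n. {\<omega> \<in> space (P x). \<exists>i\<in>{1..n}. S i \<omega> = x}"
  have "(\<Union>n. ?A n) = {\<omega> \<in> space (P x). return_time S x \<omega> < \<infinity>}"
    unfolding return_time_less_iff by (auto simp: Bex_def)
  moreover have "(\<lambda>n. prob (?A n)) \<longlonglongrightarrow> prob (\<Union>n. ?A n)"
  proof (rule finite_Lim_measure_incseq)
    have "?A n \<in> events" for n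
      unfolding return_by_iff by (rule traj_event)
    then show "range ?A \<subseteq> events" by auto
    show "incseq ?A" by (auto simp: incseq_def)
  qed
  ultimately show ?thesis by (simp only: prob_return_by return_prob_def)
qed

lemma ret_le_return_prob: "ret n x \<le> return_prob P S x"
  by (rule incseq_le[OF _ tendsto_ret]) (simp add: incseq_def ret_mono)

lemma return_prob_nonneg: "0 \<le> return_prob P S x"
  by (simp add: return_prob_def)

lemma return_prob_le_1: "return_prob P S x \<le> 1"
  unfolding return_prob_def by (rule prob_space.prob_le_1[OF prob_space_law])

lemma F1_le: "F1 P S \<le> return_prob P S x"
  unfolding F1_def by (intro cINF_lower bdd_belowI[of _ 0]) (auto simp: return_prob_nonneg)

lemma le_F2: "return_prob P S x \<le> F2 P S"
  unfolding F2_def by (intro cSUP_upper bdd_aboveI[of _ 1]) (auto simp: return_prob_le_1)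

lemma return_prob_le_ret:
  assumes "condition_U adj \<mu>" "\<delta> > 0"
  obtains m where "\<And>x. return_prob P S x \<le> ret m x + \<delta>"
proof -
  obtain m where "\<And>n x. ret n x \<le> ret m x + \<delta>" using ret_uniform[OF assms] by blast
  then have "return_prob P S x \<le> ret m x + \<delta>" for x
    by (intro LIMSEQ_le_const2[OF tendsto_ret]) auto
  then show ?thesis by (rule that)
qed

subsection \<open>Tails of the range\<close>

text \<open>With at least \<open>m\<close> steps to go, a visit is the last one with probability at
  most \<open>q\<close>; the final \<open>m\<close> positions add at most \<open>m\<close> to the
  mean. Half of \<open>\<epsilon>\<close> pays for truncation at \<open>m\<close>, half for the
  deviation.\<close>

lemma range_upper_tail:
  assumes "condition_U adj \<mu>" "\<epsilon> > 0"
  obtains C c where "C > 0" "c > 0"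
    "\<And>n x. \<P>(\<omega> in P x. real n * (1 - F1 P S + \<epsilon>) \<le> real (range_size S n \<omega>)) \<le> C * exp (- c * real n)"
proof -
  obtain m where m: "\<And>x. return_prob P S x \<le> ret m x + \<epsilon> / 2"
    using return_prob_le_ret[of "\<epsilon> / 2"] assms by auto
  define q where "q = 1 - F1 P S + \<epsilon> / 2"
  have q: "q \<ge> 0"
    using F1_le[of undefined] return_prob_le_1[of undefined] assms(2) by (simp add: q_def)
  have mean: "E n x (\<lambda>xs. real (card (set xs))) \<le> real n * q + real m" for n x
  proof -
    have "E n x (\<lambda>xs. real (card (set xs))) \<le> (\<Sum>k<n. if m \<le> k then q else 1)"
      unfolding card_set_eq_tail_count
    proof (rule E_tail_count_le)
      fix k x
      have "measure_pmf.prob (future k x) {xs. x \<notin> set xs} = 1 - ret k x"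
        using measure_pmf.prob_compl[of "{xs. x \<in> set xs}" "future k x"]
        by (simp add: prob_future_visit Compl_eq_Diff_UNIV[symmetric] Collect_neg_eq)
      also have "\<dots> \<le> (if m \<le> k then q else 1)"
        using ret_mono[of m k x] m[of x] F1_le[of x] ret_nonneg[of k x] by (auto simp: q_def)
      finally show "measure_pmf.prob (future k x) {xs. x \<notin> set xs} \<le> (if m \<le> k then q else 1)" .
    qed
    also have "\<dots> \<le> (\<Sum>k<n. q + (if k < m then 1 else 0))"
      using q by (intro sum_mono) auto
    also have "\<dots> = real n * q + real (card ({..<n} \<inter> {..<m}))"
      by (simp add: sum.distrib sum.If_cases lessThan_def)
    also have "card ({..<n} \<inter> {..<m}) \<le> m"
      using card_mono[of "{..<m}" "{..<n} \<inter> {..<m}"] by simp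
    finally show ?thesis by simp
  qed
  obtain C c where "C > 0" "c > 0" and *: "\<And>n x. measure_pmf.prob (path n x)
      {xs. real (card (set xs)) \<ge> real n * (q + \<epsilon> / 2)} \<le> C * exp (- c * real n)"
  proof (rule exponential_tail[of "\<lambda>xs. real (card (set xs))" 0 q "real m" "\<epsilon> / 2"])
    show "real (card (set (xs @ ys))) \<le> real (card (set xs)) + 0 + real (card (set ys))" for xs ys :: "'a list"
      using card_Un_le[of "set xs" "set ys"] by simp
  qed (use mean q assms in \<open>auto simp: card_length\<close>)
  moreover have "q + \<epsilon> / 2 = 1 - F1 P S + \<epsilon>" by (simp add: q_def)
  ultimately show ?thesis
    using that[of C c] prob_traj[of _ "\<lambda>xs. real n * (1 - F1 P S + \<epsilon>) \<le> real (card (set xs))" n for n]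
    by (simp add: range_size_eq)
qed

text \<open>A small range forces many quick returns \<open>A\<close> or many late returns
  \<open>J\<close>. The former are exponentially unlikely; the latter are controlled by Markov's
  inequality, which gives no rate.\<close>

lemma range_lower_tail:
  assumes "condition_U adj \<mu>" "\<epsilon> > 0" "\<eta> > 0"
  shows "\<forall>\<^sub>F n in sequentially. \<forall>x.
    \<P>(\<omega> in P x. real (range_size S n \<omega>) \<le> real n * (1 - F2 P S - \<epsilon>)) < \<eta>"
proof -
  \<comment> \<open>Markov's inequality at level \<open>n * \<epsilon> / 2\<close> then gives
    exactly \<open>\<eta> / 2\<close>.\<close>
  define \<delta> where "\<delta> = \<epsilon> * \<eta> / 4"
  have \<delta>: "\<delta> > 0" using assms by (simp add: \<delta>_def)
  obtain m where m: "\<And>x. return_prob P S x \<le> ret m x + \<delta>"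
    using return_prob_le_ret[OF assms(1) \<delta>] by auto
  define A where "A = (\<lambda>xs. real (tail_count (\<lambda>x xs :: 'a list. x \<in> set (take m xs)) xs))"
  define J where "J = (\<lambda>xs. real (tail_count (\<lambda>x xs :: 'a list. x \<in> set xs \<and> x \<notin> set (take m xs)) xs))"
  have F2: "0 \<le> F2 P S" using le_F2[of undefined] return_prob_nonneg[of undefined] by linarith
  have EA: "E n x A \<le> real n * F2 P S + 0" for n x
  proof -
    have "E n x A \<le> (\<Sum>k<n. F2 P S)"
      unfolding A_def
    proof (rule E_tail_count_le)
      fix k x
      show "measure_pmf.prob (future k x) {xs. x \<in> set (take m xs)} \<le> F2 P S"
        unfolding prob_future_visit_take
        using ret_le_return_prob[of "min m k" x] le_F2[of x] by linarith
    qed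
    then show ?thesis by simp
  qed
  have EJ: "E n x J \<le> real n * \<delta>" for n x
  proof -
    have "E n x J \<le> (\<Sum>k<n. \<delta>)"
      unfolding J_def
    proof (rule E_tail_count_le)
      fix k x
      have "measure_pmf.prob (future k x) {xs. x \<in> set xs \<and> x \<notin> set (take m xs)}
        = measure_pmf.prob (future k x) ({xs. x \<in> set xs} - {xs. x \<in> set (take m xs)})"
        by (intro arg_cong[where f = "measure _"]) auto
      also have "\<dots> = ret k x - ret (min m k) x"
        by (subst measure_pmf.finite_measure_Diff)
          (auto simp: prob_future_visit prob_future_visit_take dest: in_set_takeD)
      \<comment> \<open>For \<open>k < m\<close> the difference is zero; otherwise it is the gap
        between \<open>ret k x\<close> and \<open>ret m x\<close>.\<close>
      also have "\<dots> \<le> \<delta>"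
        using m[of x] ret_le_return_prob[of k x] \<delta> by (cases "m \<le> k") (auto simp: min_def)
      finally show "measure_pmf.prob (future k x) {xs. x \<in> set xs \<and> x \<notin> set (take m xs)} \<le> \<delta>" .
    qed
    then show ?thesis by simp
  qed
  obtain C c where C: "C > 0" "c > 0" and *: "\<And>n x. measure_pmf.prob (path n x)
      {xs. A xs \<ge> real n * (F2 P S + \<epsilon> / 2)} \<le> C * exp (- c * real n)"
  proof (rule exponential_tail[of A "real m" "F2 P S" 0 "\<epsilon> / 2"])
    show "A (xs @ ys) \<le> A xs + real m + A ys" for xs ys
      using tail_count_take_append[of m xs ys] unfolding A_def by linarith
    show "A xs \<le> real (length xs)" for xs
      by (simp add: A_def tail_count_le_length)
  qed (use EA F2 assms in \<open>auto simp: A_def\<close>)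
  have "(\<lambda>n. C * exp (- c * real n)) \<longlonglongrightarrow> 0" using C by real_asymp
  then have "\<forall>\<^sub>F n in sequentially. C * exp (- c * real n) < \<eta> / 2"
    using assms by (intro order_tendstoD(2)) auto
  then show ?thesis
    using eventually_gt_at_top[of 0]
  proof eventually_elim
    case (elim n)
    show ?case
    proof
      fix x
      let ?p = "measure_pmf.prob (path n x)"
      have "\<P>(\<omega> in P x. real (range_size S n \<omega>) \<le> real n * (1 - F2 P S - \<epsilon>))
        = ?p {xs. real (card (set xs)) \<le> real n * (1 - F2 P S - \<epsilon>)}"
        using prob_traj[of x "\<lambda>xs. real (card (set xs)) \<le> real n * (1 - F2 P S - \<epsilon>)" n]
        by (simp add: range_size_eq)
      also have "\<dots> \<le> ?p ({xs. A xs \<ge> real n * (F2 P S + \<epsilon> / 2)} \<union> {xs. J xs \<ge> real n * \<epsilon> / 2})"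
      proof (rule measure_pmf.finite_measure_mono_AE[OF AE_pmfI])
        fix xs assume "xs \<in> set_pmf (path n x)"
        then have "length xs = n" by (rule length_path)
        then have "real n \<le> real (card (set xs)) + A xs + J xs"
          using length_le_card_set_plus[of xs m] unfolding A_def J_def by linarith
        \<comment> \<open>On this event \<open>A + J\<close> is at least
          \<open>n * (F2 P S + \<epsilon>)\<close>, so one summand reaches its share.\<close>
        then show "xs \<in> {xs. real (card (set xs)) \<le> real n * (1 - F2 P S - \<epsilon>)} \<longrightarrow>
          xs \<in> {xs. A xs \<ge> real n * (F2 P S + \<epsilon> / 2)} \<union> {xs. J xs \<ge> real n * \<epsilon> / 2}"
          by (auto simp: algebra_simps)
      qed auto
      also have "\<dots> \<le> ?p {xs. A xs \<ge> real n * (F2 P S + \<epsilon> / 2)} + ?p {xs. J xs \<ge> real n * \<epsilon> / 2}"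
        by (rule measure_Un_le) auto
      also have "?p {xs. J xs \<ge> real n * \<epsilon> / 2} \<le> E n x J / (real n * \<epsilon> / 2)"
        using integral_Markov_inequality_measure[of "path n x" J "{}" "real n * \<epsilon> / 2"] elim assms
        by (simp add: J_def)
      also have "\<dots> \<le> real n * \<delta> / (real n * \<epsilon> / 2)"
        using EJ assms by (intro divide_right_mono) auto
      also have "\<dots> = \<eta> / 2" using elim assms by (simp add: \<delta>_def)
      also have "?p {xs. A xs \<ge> real n * (F2 P S + \<epsilon> / 2)} < \<eta> / 2"
        using *[of n x] elim by linarith
      finally show "\<P>(\<omega> in P x. real (range_size S n \<omega>) \<le> real n * (1 - F2 P S - \<epsilon>)) < \<eta>"
        by simp
    qed
  qed
qed

end

theorem theorem1p2:
  fixes adj :: "'a \<Rightarrow> 'a \<Rightarrow> bool" and \<mu> :: "'a \<Rightarrow> 'a \<Rightarrow> real"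
    and P :: "'a \<Rightarrow> 'w measure" and S :: "nat \<Rightarrow> 'w \<Rightarrow> 'a" and \<epsilon> :: real
  assumes "random_walk adj \<mu> P S" and "condition_U adj \<mu>" and "\<epsilon> > 0"
  shows "(\<forall>x. (\<lambda>n. \<P>(\<omega> in P x. real (range_size S n \<omega>) \<ge> real n * (1 - F1 P S + \<epsilon>)))
              \<longlonglongrightarrow> 0)
       \<and> (\<forall>x. (\<lambda>n. \<P>(\<omega> in P x. real (range_size S n \<omega>) \<le> real n * (1 - F2 P S - \<epsilon>)))
              \<longlonglongrightarrow> 0)
       \<and> uniform_limit UNIV
           (\<lambda>n x. \<P>(\<omega> in P x. real (range_size S n \<omega>) \<ge> real n * (1 - F1 P S + \<epsilon>)))
           (\<lambda>_. 0) sequentially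
       \<and> uniform_limit UNIV
           (\<lambda>n x. \<P>(\<omega> in P x. real (range_size S n \<omega>) \<le> real n * (1 - F2 P S - \<epsilon>)))
           (\<lambda>_. 0) sequentially
       \<and> exponentially_fast
           (\<lambda>n. SUP x. \<P>(\<omega> in P x. real (range_size S n \<omega>) \<ge> real n * (1 - F1 P S + \<epsilon>)))"
proof -
  interpret random_walk adj \<mu> P S by (rule assms(1))
  let ?u = "\<lambda>n x. \<P>(\<omega> in P x. real (range_size S n \<omega>) \<ge> real n * (1 - F1 P S + \<epsilon>))"
  let ?l = "\<lambda>n x. \<P>(\<omega> in P x. real (range_size S n \<omega>) \<le> real n * (1 - F2 P S - \<epsilon>))"
  \<comment> \<open>One bound for all starting points yields both the uniform limit and the rate for
    the supremum.\<close>
  obtain C c where C: "C > 0" "c > 0" "\<And>n x. ?u n x \<le> C * exp (- c * real n)"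
    using range_upper_tail[OF assms(2,3)] by blast
  have u: "uniform_limit UNIV ?u (\<lambda>_. 0) sequentially"
  proof (rule uniform_limitI)
    fix e :: real assume e: "e > 0"
    have "(\<lambda>n. C * exp (- c * real n)) \<longlonglongrightarrow> 0" using C by real_asymp
    then have "\<forall>\<^sub>F n in sequentially. C * exp (- c * real n) < e"
      using e by (intro order_tendstoD(2)) auto
    then show "\<forall>\<^sub>F n in sequentially. \<forall>x\<in>UNIV. dist (?u n x) 0 < e"
      by eventually_elim (use C(3) in \<open>auto intro: le_less_trans\<close>)
  qed
  have l: "uniform_limit UNIV ?l (\<lambda>_. 0) sequentially"
    by (rule uniform_limitI) (use range_lower_tail[OF assms(2,3)] in simp)
  have "exponentially_fast (\<lambda>n. SUP x. ?u n x)"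
    unfolding exponentially_fast_def using C by (blast intro: cSUP_least)
  with u l show ?thesis
    using tendsto_uniform_limitI[OF u] tendsto_uniform_limitI[OF l] by auto
qed

end
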